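(* Let $\mathcal{B}$ be a real symmetric tensor of even order $m$ and dimension $n$. If $\mathcal{B}$ is a double $B$-tensor, or a quasi-double $B_0$-tensor, or an $MB_0$-tensor, then $\mathcal{B}$ has an SOS tensor decomposition.
   Context: A real tensor of order $m$ and dimension $n$ is an array $\mathcal{B}=(b_{i_1\cdots i_m})$ with $i_1,\dots,i_m\in[n]=\{1,\dots,n\}$; it is symmetric if its entries are invariant under permutations of the indices. Its associated form is $f_{\mathcal{B}}(\mathbf{x})=\mathcal{B}\mathbf{x}^m=\sum_{i_1,\dots,i_m\in[n]}b_{i_1\cdots i_m}x_{i_1}\cdots x_{i_m}$. For even $m$, $\mathcal{B}$ has an SOS tensor decomposition if $f_{\mathcal{B}}$ is a finite sum of squares of real polynomials. Let $I=\{(i,\dots,i):i\in[n]\}\subset[n]^m$. For a symmetric tensor $\mathcal{B}$ define $\beta_i(\mathcal{B})=\max_{(i,j_2,\dots,j_m)\notin I}\{0,b_{ij_2\cdots j_m}\}$, $\Delta_i(\mathcal{B})=\sum_{(i,j_2,\dots,j_m)\notin I}(\beta_i(\mathcal{B})-b_{ij_2\cdots j_m})$, and $\Delta^i_j(\mathcal{B})=\Delta_j(\mathcal{B})-(\beta_j(\mathcal{B})-b_{jii\cdots i})$ for $i\ne j$. $\mathcal{B}$ is a double $B$-tensor if $b_{ii\cdots i}>\beta_i(\mathcal{B})$ for all $i\in[n]$, and for all $i,j\in[n]$ with $i\ne j$: $b_{ii\cdots i}-\beta_i(\mathcal{B})\ge\Delta_i(\mathcal{B})$ and $(b_{ii\cdots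 i}-\beta_i(\mathcal{B}))(b_{jj\cdots j}-\beta_j(\mathcal{B}))>\Delta_i(\mathcal{B})\Delta_j(\mathcal{B})$. $\mathcal{B}$ is a quasi-double $B_0$-tensor if $b_{ii\cdots i}>\beta_i(\mathcal{B})$ for all $i\in[n]$ and, for all $i,j\in[n]$ with $i\neq j$, $(b_{ii\cdots i}-\beta_i(\mathcal{B}))(b_{jj\cdots j}-\beta_j(\mathcal{B})-\Delta^i_j(\mathcal{B}))\ge(\beta_j(\mathcal{B})-b_{ji\cdots i})\Delta_i(\mathcal{B})$. $\mathcal{B}$ is an $MB_0$-tensor if the tensor $\mathcal{A}=(a_{i_1\cdots i_m})$ with $a_{i_1i_2\cdots i_m}=b_{i_1i_2\cdots i_m}-\beta_{i_1}(\mathcal{B})$ is an $M$-tensor. A (not necessarily symmetric) tensor $\mathcal{A}$ is an $M$-tensor if $\mathcal{A}=s\mathcal{I}-\mathcal{Z}$ with $\mathcal{Z}$ entrywise nonnegative and $s\ge\rho(\mathcal{Z})$. Here $\mathcal{I}$ is the identity tensor (entries $1$ if all indices are equal, $0$ otherwise), and $\rho(\mathcal{Z})$ is the maximum modulus of all eigenvalues of $\mathcal{Z}=(z_{i_1\cdots i_m})$, where $\lambda\in\mathbb{C}$ is an eigenvalue if there is $\mathbf{x}\in\mathbb{C}^n\setminus\{0\}$ with $\sum_{i_2,\dots,i_m=1}^n z_{ii_2\cdots i_m}x_{i_2}\cdots x_{i_m}=\lambda x_i^{m-1}$ for all $i\in[n]$. *)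

theory Defs
  imports "HOL-Analysis.Analysis" "HOL-Combinatorics.Permutations"
begin

text \<open>
  A real tensor of order \<open>m\<close> and dimension \<open>n = CARD('n)\<close> is a function on index tuples, which are
  lists over \<open>'n\<close>.  The order \<open>m\<close> is an explicit parameter; only the values on lists of
  length \<open>m\<close> are ever used.  An entry with distinguished first index \<open>i\<close> is \<open>b (i # js)\<close>
  with \<open>js\<close> of length \<open>m - 1\<close>.
\<close>

type_synonym 'n tensor = "'n list \<Rightarrow> real"

definition symmetric_tensor :: "nat \<Rightarrow> 'n tensor \<Rightarrow> bool" where
  "symmetric_tensor m b \<longleftrightarrow>
     (\<forall>is p. length is = m \<longrightarrow> p permutes {..<m} \<longrightarrow> b (permute_list p is) = b is)"

definition tensor_form :: "nat \<Rightarrow> 'n::finite tensor \<Rightarrow> real ^ 'n \<Rightarrow> real" where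
  "tensor_form m b x = (\<Sum>is | length is = m. b is * (\<Prod>i\<leftarrow>is. x $ i))"

text \<open>
  Real polynomials in \<open>n\<close> variables are identified with the polynomial functions on \<open>real ^ 'n\<close>
  that they induce.
\<close>

definition sum_of_squares :: "(real ^ 'n::finite \<Rightarrow> real) \<Rightarrow> bool" where
  "sum_of_squares f \<longleftrightarrow>
     (\<exists>(k::nat) g. (\<forall>l<k. real_polynomial_function (g l)) \<and> (\<forall>x. f x = (\<Sum>l<k. (g l x)\<^sup>2)))"

definition has_SOS_decomposition :: "nat \<Rightarrow> 'n::finite tensor \<Rightarrow> bool" where
  "has_SOS_decomposition m b \<longleftrightarrow> sum_of_squares (tensor_form m b)"

text \<open>The tails \<open>js\<close> for which \<open>i # js\<close> is not a diagonal index.\<close>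

definition offdiag :: "nat \<Rightarrow> 'n \<Rightarrow> 'n list set" where
  "offdiag m i = {js. length js = m - 1 \<and> js \<noteq> replicate (m - 1) i}"

definition tensor_beta :: "nat \<Rightarrow> 'n::finite tensor \<Rightarrow> 'n \<Rightarrow> real" where
  "tensor_beta m b i = Max (insert 0 ((\<lambda>js. b (i # js)) ` offdiag m i))"

definition tensor_Delta :: "nat \<Rightarrow> 'n::finite tensor \<Rightarrow> 'n \<Rightarrow> real" where
  "tensor_Delta m b i = (\<Sum>js\<in>offdiag m i. tensor_beta m b i - b (i # js))"

text \<open>\<open>tensor_Delta_except m b i j\<close> is \<open>\<Delta>\<^sup>i\<^sub>j\<close>: the row is \<open>j\<close>, the omitted entry is \<open>b\<^sub>j\<^sub>i\<^sub>\<dots>\<^sub>i\<close>.\<close>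

definition tensor_Delta_except :: "nat \<Rightarrow> 'n::finite tensor \<Rightarrow> 'n \<Rightarrow> 'n \<Rightarrow> real" where
  "tensor_Delta_except m b i j =
     tensor_Delta m b j - (tensor_beta m b j - b (j # replicate (m - 1) i))"

definition double_B_tensor :: "nat \<Rightarrow> 'n::finite tensor \<Rightarrow> bool" where
  "double_B_tensor m b \<longleftrightarrow>
     (\<forall>i. b (replicate m i) > tensor_beta m b i) \<and>
     (\<forall>i j. i \<noteq> j \<longrightarrow>
        b (replicate m i) - tensor_beta m b i \<ge> tensor_Delta m b i \<and>
        (b (replicate m i) - tensor_beta m b i) * (b (replicate m j) - tensor_beta m b j)
          > tensor_Delta m b i * tensor_Delta m b j)"

definition quasi_double_B0_tensor :: "nat \<Rightarrow> 'n::finite tensor \<Rightarrow> bool" where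
  "quasi_double_B0_tensor m b \<longleftrightarrow>
     (\<forall>i. b (replicate m i) > tensor_beta m b i) \<and>
     (\<forall>i j. i \<noteq> j \<longrightarrow>
        (b (replicate m i) - tensor_beta m b i) *
          (b (replicate m j) - tensor_beta m b j - tensor_Delta_except m b i j)
        \<ge> (tensor_beta m b j - b (j # replicate (m - 1) i)) * tensor_Delta m b i)"

definition identity_tensor :: "nat \<Rightarrow> 'n tensor" where
  "identity_tensor m is = (if \<exists>i. is = replicate m i then 1 else 0)"

definition tensor_eigenvalue :: "nat \<Rightarrow> 'n::finite tensor \<Rightarrow> complex \<Rightarrow> bool" where
  "tensor_eigenvalue m z ev \<longleftrightarrow>
     (\<exists>x :: complex ^ 'n. x \<noteq> 0 \<and>
        (\<forall>i. (\<Sum>js | length js = m - 1. of_real (z (i # js)) * (\<Prod>j\<leftarrow>js. x $ j))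
               = ev * (x $ i) ^ (m - 1)))"

text \<open>
  For \<open>m \<ge> 2\<close> the set of eigenvalues is nonempty and compact (in fact finite), so the supremum
  below is the maximum modulus of the eigenvalues.
\<close>

definition tensor_spectral_radius :: "nat \<Rightarrow> 'n::finite tensor \<Rightarrow> real" where
  "tensor_spectral_radius m z = (SUP ev\<in>{ev. tensor_eigenvalue m z ev}. cmod ev)"

definition M_tensor :: "nat \<Rightarrow> 'n::finite tensor \<Rightarrow> bool" where
  "M_tensor m a \<longleftrightarrow>
     (\<exists>s z. (\<forall>is. length is = m \<longrightarrow> z is \<ge> 0) \<and>
            (\<forall>is. length is = m \<longrightarrow> a is = s * identity_tensor m is - z is) \<and>
            s \<ge> tensor_spectral_radius m z)"

definition MB0_tensor :: "nat \<Rightarrow> 'n::finite tensor \<Rightarrow> bool" where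
  "MB0_tensor m b \<longleftrightarrow> M_tensor m (\<lambda>is. b is - tensor_beta m b (hd is))"

end

theory Submission
  imports Defs
begin

text \<open>
  Let \<open>c\<close> be the tensor whose entries are the minima of \<open>\<beta>\<close> over the indices. By symmetry of \<open>b\<close>
  the off-diagonal entries of \<open>b - c\<close> are nonpositive, and the form of \<open>c\<close> is a nonnegative
  combination of even powers of partial sums of the variables. Write \<open>b - c = s I - Z'\<close> and
  \<open>b - \<beta> = s I - Z\<close>, so that \<open>0 \<le> Z' \<le> Z\<close>. In each of the three cases no eigenvalue of \<open>Z\<close> with a
  nonnegative eigenvector exceeds \<open>s\<close>, so there are positive \<open>y\<close> with
  \<open>Z' y^(m-1) \<le> s' y^(m-1)\<close> and \<open>s'\<close> tending to a limit that is at most \<open>s\<close>. Rescaling the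
  variables by \<open>y\<close> splits the form of \<open>s' I - Z'\<close> into even powers with nonnegative coefficients
  and AM-GM differences, which are sums of squares by Hurwitz. The weights of this splitting are
  bounded, so they have a limit along a subsequence, and the limit splits the form of \<open>s I - Z'\<close>.
\<close>

subsection \<open>Sums of squares and the inequality of arithmetic and geometric means\<close>

text \<open>An arbitrary finite index set is allowed here, so that sums and products of
  decompositions can be indexed by disjoint unions and Cartesian products.\<close>

lemma sum_of_squaresI:
  assumes "finite I" "\<And>i. i \<in> I \<Longrightarrow> real_polynomial_function (g i)"
    and "\<And>x. f x = (\<Sum>i\<in>I. (g i x)\<^sup>2)"
  shows "sum_of_squares f"
proof -
  obtain h where h: "bij_betw h {0..<card I} I"
    using ex_bij_betw_nat_finite[OF assms(1)] by blast
  have "f x = (\<Sum>l<card I. (g (h l) x)\<^sup>2)" for x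
    using sum.reindex_bij_betw[OF h, of "\<lambda>i. (g i x)\<^sup>2"] by (simp add: assms(3) atLeast0LessThan)
  moreover have "real_polynomial_function (g (h l))" if "l < card I" for l
    using bij_betwE[OF h] that assms(2) by simp
  ultimately show ?thesis
    unfolding sum_of_squares_def by (intro exI[of _ "card I"] exI[of _ "\<lambda>l. g (h l)"]) simp
qed

lemma sum_of_squares_square:
  "real_polynomial_function g \<Longrightarrow> sum_of_squares (\<lambda>x. (g x)\<^sup>2)"
  by (rule sum_of_squaresI[of "{()}" "\<lambda>_. g"]) auto

lemma sum_of_squares_const: "c \<ge> 0 \<Longrightarrow> sum_of_squares (\<lambda>x. c)"
  using sum_of_squares_square[of "\<lambda>x. sqrt c"] by (simp add: real_polynomial_function.intros(2))

lemma sum_of_squares_add: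
  assumes "sum_of_squares f" "sum_of_squares g"
  shows "sum_of_squares (\<lambda>x. f x + g x)"
proof -
  from assms obtain k f' l g' where
    f: "\<forall>i<k::nat. real_polynomial_function (f' i)" "\<forall>x. f x = (\<Sum>i<k. (f' i x)\<^sup>2)" and
    g: "\<forall>i<l::nat. real_polynomial_function (g' i)" "\<forall>x. g x = (\<Sum>i<l. (g' i x)\<^sup>2)"
    unfolding sum_of_squares_def by blast
  show ?thesis
    by (rule sum_of_squaresI[of "{..<k} <+> {..<l}" "case_sum f' g'"])
       (use f g in \<open>auto simp: sum.Plus\<close>)
qed

lemma sum_of_squares_mult:
  assumes "sum_of_squares f" "sum_of_squares g"
  shows "sum_of_squares (\<lambda>x. f x * g x)"
proof -
  from assms obtain k f' l g' where
    f: "\<forall>i<k::nat. real_polynomial_function (f' i)" "\<forall>x. f x = (\<Sum>i<k. (f' i x)\<^sup>2)" and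
    g: "\<forall>i<l::nat. real_polynomial_function (g' i)" "\<forall>x. g x = (\<Sum>i<l. (g' i x)\<^sup>2)"
    unfolding sum_of_squares_def by blast
  show ?thesis
    by (rule sum_of_squaresI[of "{..<k} \<times> {..<l}" "\<lambda>(i, j) x. f' i x * g' j x"])
       (use f g in \<open>auto simp: sum_product sum.cartesian_product power_mult_distrib
          case_prod_unfold intro!: real_polynomial_function.intros(4)\<close>)
qed

lemma sum_of_squares_sum:
  "finite A \<Longrightarrow> (\<And>a. a \<in> A \<Longrightarrow> sum_of_squares (f a)) \<Longrightarrow> sum_of_squares (\<lambda>x. \<Sum>a\<in>A. f a x)"
  by (induction A rule: finite_induct) (auto intro: sum_of_squares_const sum_of_squares_add)

lemma sum_of_squares_power:
  "sum_of_squares f \<Longrightarrow> sum_of_squares (\<lambda>x. f x ^ k)"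
  by (induction k) (auto intro: sum_of_squares_const sum_of_squares_mult)

lemma sum_of_squares_even_power:
  assumes "real_polynomial_function g" "even k"
  shows "sum_of_squares (\<lambda>x. g x ^ k)"
proof -
  from \<open>even k\<close> obtain l where "k = 2 * l" by blast
  then show ?thesis
    using sum_of_squares_power[OF sum_of_squares_square[OF assms(1)], of l] by (simp add: power_mult)
qed

lemma real_polynomial_function_sum_of_squares:
  assumes "sum_of_squares f"
  shows "real_polynomial_function f"
proof -
  obtain k g where "\<forall>i<k::nat. real_polynomial_function (g i)" "\<forall>x. f x = (\<Sum>i<k. (g i x)\<^sup>2)"
    using assms unfolding sum_of_squares_def by blast
  moreover from this(2) have "f = (\<lambda>x. \<Sum>i<k. (g i x)\<^sup>2)" by blast
  ultimately show ?thesis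
    by (simp only:) (intro real_polynomial_function_sum real_polynomial_function_power, simp_all)
qed

text \<open>The first factor is itself \<open>f - g\<close> times the sum of the products
  \<open>f^i g^(p-1-i)\<close>. The two differences make a square, and the remaining sum consists of
  products of sums of squares.\<close>

lemma sum_of_squares_power_diff_mult_diff:
  assumes "sum_of_squares f" "sum_of_squares g"
  shows "sum_of_squares (\<lambda>x. (f x ^ p - g x ^ p) * (f x - g x))"
proof -
  have "(\<lambda>x. (f x ^ p - g x ^ p) * (f x - g x)) =
      (\<lambda>x. (f x - g x)\<^sup>2 * (\<Sum>i<p. g x ^ (p - Suc i) * f x ^ i))"
    by (simp add: power_diff_sumr2 power2_eq_square algebra_simps)
  moreover have "sum_of_squares \<dots>"
    using assms
    by (intro sum_of_squares_mult sum_of_squares_square real_polynomial_function_diff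
        sum_of_squares_sum sum_of_squares_power real_polynomial_function_sum_of_squares) auto
  ultimately show ?thesis by simp
qed

text \<open>Hurwitz's inequality: the induction hypotheses for all \<open>A - {j}\<close>, multiplied by \<open>y\<^sub>j\<close>, leave
  \<open>p \<Sum>\<^sub>k y\<^sub>k^(p+1) - \<Sum>\<^sub>j\<^sub>\<noteq>\<^sub>k y\<^sub>j y\<^sub>k^p\<close>, which is half the sum of all
  \<open>(y\<^sub>j^p - y\<^sub>k^p) (y\<^sub>j - y\<^sub>k)\<close>.\<close>

lemma sum_of_squares_AM_GM:
  fixes y :: "'k \<Rightarrow> real ^ 'n::finite \<Rightarrow> real"
  assumes "finite A" "\<And>k. k \<in> A \<Longrightarrow> sum_of_squares (y k)"
  shows "sum_of_squares (\<lambda>x. (\<Sum>k\<in>A. y k x ^ card A) - real (card A) * (\<Prod>k\<in>A. y k x))"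
  using assms
proof (induction "card A" arbitrary: A)
  case 0
  then show ?case by (simp add: sum_of_squares_const)
next
  case (Suc p)
  note fin = \<open>finite A\<close>
  show ?case
  \<comment> \<open>The reduction formula divides by \<open>p\<close>, so singletons are treated
    separately.\<close>
  proof (cases "p = 0")
    case True
    then obtain a where "A = {a}" using Suc(2) by (metis One_nat_def card_1_singletonE)
    then show ?thesis by (simp add: sum_of_squares_const)
  next
    case False
    define R where "R j x = (\<Sum>k\<in>A - {j}. y k x ^ p) - real p * (\<Prod>k\<in>A - {j}. y k x)" for j x
    have R: "sum_of_squares (R j)" if "j \<in> A" for j
    proof -
      have "card (A - {j}) = p" using Suc(2) that fin by simp
      then show ?thesis
        using Suc(1)[of "A - {j}"] Suc.prems unfolding R_def by simp
    qed
    have "(\<Sum>k\<in>A. y k x ^ card A) - real (card A) * (\<Prod>k\<in>A. y k x) =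
       (1 / real p) * ((\<Sum>j\<in>A. y j x * R j x) +
        (1/2) * (\<Sum>j\<in>A. \<Sum>k\<in>A. (y j x ^ p - y k x ^ p) * (y j x - y k x)))" for x
    proof -
      define P where "P = (\<Prod>k\<in>A. y k x)"
      define s where "s q = (\<Sum>k\<in>A. y k x ^ q)" for q
      have "y j x * R j x = y j x * s p - y j x ^ (p + 1) - p * P" if "j \<in> A" for j
        using prod.remove[OF fin that, of "\<lambda>k. y k x"] sum.remove[OF fin that, of "\<lambda>k. y k x ^ p"]
        by (simp add: R_def P_def s_def algebra_simps)
      then have 1: "(\<Sum>j\<in>A. y j x * R j x) = s 1 * s p - s (p + 1) - card A * p * P"
        by (simp add: sum_subtractf sum_distrib_right s_def)
      have 2: "(\<Sum>j\<in>A. \<Sum>k\<in>A. (y j x ^ p - y k x ^ p) * (y j x - y k x)) =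
          2 * card A * s (p + 1) - 2 * (s 1 * s p)"
      proof -
        have "(\<Sum>j\<in>A. \<Sum>k\<in>A. (y j x ^ p - y k x ^ p) * (y j x - y k x)) =
          (\<Sum>j\<in>A. \<Sum>k\<in>A. y j x ^ (p + 1) + y k x ^ (p + 1) - y j x * y k x ^ p - y j x ^ p * y k x)"
          by (intro sum.cong refl) (simp add: algebra_simps)
        also have "\<dots> = 2 * card A * s (p + 1) - s 1 * s p - s p * s 1"
          unfolding s_def
          by (simp only: sum_subtractf sum.distrib sum_constant sum_distrib_left[symmetric]
              sum_distrib_right[symmetric]) simp
        finally show ?thesis by simp
      qed
      have "real (card A) = p + 1" using Suc(2) by simp
      then show ?thesis
        using False unfolding 1 2 P_def[symmetric] s_def[symmetric] Suc(2)[symmetric]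
        by (simp add: field_simps)
    qed
    moreover have "sum_of_squares (\<lambda>x. (1 / real p) * ((\<Sum>j\<in>A. y j x * R j x) +
        (1/2) * (\<Sum>j\<in>A. \<Sum>k\<in>A. (y j x ^ p - y k x ^ p) * (y j x - y k x))))"
      using Suc.prems R
      by (intro sum_of_squares_mult sum_of_squares_const sum_of_squares_add sum_of_squares_sum
          sum_of_squares_power_diff_mult_diff) auto
    ultimately show ?thesis by simp
  qed
qed

text \<open>The \<open>g k\<close> may change sign, so Hurwitz's inequality is applied to their
  squares, separately for the first and the second half of the \<open>m = 2 p\<close> factors. If
  \<open>U\<close> and \<open>V\<close> are the products over the halves, this leaves
  \<open>p (U^2 + V^2) - 2 p U V\<close>, which is \<open>p (U - V)^2\<close>.\<close>

lemma sum_of_squares_AM_GM_even: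
  assumes "even m" "\<And>k. k < m \<Longrightarrow> real_polynomial_function (g k)"
  shows "sum_of_squares (\<lambda>x. (\<Sum>k<m. g k x ^ m) - m * (\<Prod>k<m. g k x))"
proof -
  obtain p where m: "m = 2 * p" using assms(1) by blast
  define D where "D A x = (\<Sum>k\<in>A. (g k x)\<^sup>2 ^ card A) - real (card A) * (\<Prod>k\<in>A. (g k x)\<^sup>2)" for A x
  have D: "sum_of_squares (D A)" if "A \<subseteq> {..<m}" for A
    unfolding D_def
    using that assms(2) finite_subset[OF that]
    by (intro sum_of_squares_AM_GM[where y = "\<lambda>k x. (g k x)\<^sup>2"]) (auto intro: sum_of_squares_square)
  have split: "{..<m} = {..<p} \<union> {p..<m}" "{..<p} \<inter> {p..<m} = {}" using m by auto
  have poly: "real_polynomial_function (\<lambda>x. (\<Prod>k<p. g k x) - (\<Prod>k=p..<m. g k x))"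
    using assms(2) m by (intro real_polynomial_function_diff real_polynomial_function_prod) auto
  have "(\<Sum>k<m. g k x ^ m) - m * (\<Prod>k<m. g k x) =
      D {..<p} x + D {p..<m} x + p * ((\<Prod>k<p. g k x) - (\<Prod>k=p..<m. g k x))\<^sup>2" for x
  proof -
    have "(\<Sum>k<m. g k x ^ m) = (\<Sum>k<p. g k x ^ m) + (\<Sum>k=p..<m. g k x ^ m)"
      unfolding split(1) by (rule sum.union_disjoint) (use split in auto)
    moreover have "(\<Prod>k<m. g k x) = (\<Prod>k<p. g k x) * (\<Prod>k=p..<m. g k x)"
      unfolding split(1) by (rule prod.union_disjoint) (use split in auto)
    moreover have "card {..<p} = p" "card {p..<m} = p" using m by auto
    moreover have "(u\<^sup>2) ^ p = u ^ m" for u :: real by (simp add: m power_mult)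
    moreover have "real m = 2 * p" using m by simp
    ultimately show ?thesis
      unfolding D_def prod_power_distrib[symmetric] by (simp add: power2_eq_square algebra_simps)
  qed
  moreover have "sum_of_squares (\<lambda>x. D {..<p} x + D {p..<m} x +
      p * ((\<Prod>k<p. g k x) - (\<Prod>k=p..<m. g k x))\<^sup>2)"
    using poly m by (intro sum_of_squares_add D sum_of_squares_mult sum_of_squares_const
        sum_of_squares_square) auto
  ultimately show ?thesis by simp
qed

text \<open>The \<open>m\<close>-th roots of the weights are absorbed into the factors; the
  condition on the product of the weights is what turns the coefficient \<open>m\<close> of the
  unweighted version into \<open>c\<close>.\<close>

lemma sum_of_squares_weighted_AM_GM:
  assumes "even m" "m > 0" "\<And>k. k < m \<Longrightarrow> real_polynomial_function (g k)"
    and "\<And>k. k < m \<Longrightarrow> w k \<ge> 0" "c \<ge> 0" "(\<Prod>k<m. w k) = (c / m) ^ m"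
  shows "sum_of_squares (\<lambda>x. (\<Sum>k<m. w k * g k x ^ m) - c * (\<Prod>k<m. g k x))"
proof -
  have "(\<Prod>k<m. root m (w k)) ^ m = (c / m) ^ m"
    unfolding assms(6)[symmetric] prod_power_distrib
    by (intro prod.cong refl) (use assms in \<open>simp add: real_root_pow_pos2\<close>)
  then have "(\<Prod>k<m. root m (w k)) = c / m"
    by (rule power_eq_imp_eq_base) (use assms(2,4,5) in \<open>auto intro!: prod_nonneg\<close>)
  then have "m * (\<Prod>k<m. root m (w k) * g k x) = c * (\<Prod>k<m. g k x)" for x
    using assms(2) by (simp add: prod.distrib)
  moreover have "(\<Sum>k<m. (root m (w k) * g k x) ^ m) = (\<Sum>k<m. w k * g k x ^ m)" for x
    by (intro sum.cong refl) (use assms in \<open>simp add: power_mult_distrib real_root_pow_pos2\<close>)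
  moreover have "sum_of_squares (\<lambda>x. (\<Sum>k<m. (root m (w k) * g k x) ^ m) -
      m * (\<Prod>k<m. root m (w k) * g k x))"
    using assms by (intro sum_of_squares_AM_GM_even real_polynomial_function.intros(2,4)) simp_all
  ultimately show ?thesis by simp
qed

subsection \<open>Sums over index lists and the minimum tensor\<close>

lemma finite_lists_of_length [simp]: "finite {xs :: 'n::finite list. length xs = k}"
  using finite_lists_length_eq[of "UNIV :: 'n set" k] by simp

lemma sum_lists_of_length_Suc:
  fixes f :: "'n::finite list \<Rightarrow> 'b::comm_monoid_add"
  shows "(\<Sum>is | length is = Suc k. f is) = (\<Sum>i\<in>UNIV. \<Sum>js | length js = k. f (i # js))"
proof -
  have "(\<Sum>is | length is = Suc k. f is) = (\<Sum>(i, js)\<in>UNIV \<times> {js. length js = k}. f (i # js))"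
    by (rule sum.reindex_bij_witness[of _ "\<lambda>(i, js). i # js" "\<lambda>is. (hd is, tl is)"])
       (auto simp: length_Suc_conv)
  then show ?thesis by (simp add: sum.cartesian_product)
qed

lemma sum_lists_of_length_hd:
  fixes f :: "'n::finite list \<Rightarrow> 'b::comm_monoid_add"
  assumes "m > 0"
  shows "(\<Sum>is | length is = m \<and> is ! 0 = i. f is) = (\<Sum>js | length js = m - 1. f (i # js))"
  by (rule sum.reindex_bij_witness[of _ "\<lambda>js. i # js" tl])
     (use assms in \<open>auto simp: length_Suc_conv gr0_conv_Suc\<close>)

lemma sum_lists_prod_list:
  fixes g :: "'n::finite \<Rightarrow> 'b::comm_semiring_1"
  shows "(\<Sum>is | length is = k. \<Prod>i\<leftarrow>is. g i) = (\<Sum>i\<in>UNIV. g i) ^ k"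
proof (induction k)
  case 0
  have "{is :: 'n list. is = []} = {[]}" by auto
  then show ?case by simp
next
  case (Suc k)
  then show ?case
    by (simp add: sum_lists_of_length_Suc sum_distrib_left[symmetric] sum_distrib_right[symmetric])
qed

lemma prod_list_map_nth: "(\<Prod>i\<leftarrow>is. f i) = (\<Prod>k<length is. f (is ! k) :: 'b::comm_monoid_mult)"
  by (simp add: prod.list_conv_set_nth atLeast0LessThan)

lemma real_polynomial_function_nth:
  "real_polynomial_function (\<lambda>x :: real ^ 'n::finite. x $ i)"
  by (intro real_polynomial_function.intros(1) bounded_linear_vec_nth)

text \<open>Peels \<open>w\<close> into layers. With \<open>J\<close> the support of
  \<open>w\<close> and \<open>d\<close> its least positive value, the minimum over an index list is
  \<open>d\<close> if the list stays in \<open>J\<close>, plus the minimum for the reduced function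
  \<open>w'\<close>. The first part has the form \<open>d * (\<Sum>i\<in>J. x $ i) ^ m\<close>, an
  even power, and \<open>w'\<close> has a smaller support.\<close>

lemma sum_of_squares_Min_tensor:
  fixes w :: "'n::finite \<Rightarrow> real"
  assumes "even m" "m > 0" "\<And>i. w i \<ge> 0"
  shows "sum_of_squares (tensor_form m (\<lambda>is. Min (w ` set is)))"
  using assms(3)
proof (induction "card {i. w i > 0}" arbitrary: w rule: less_induct)
  case less
  define J where "J = {i. w i > 0}"
  show ?case
  proof (cases "J = {}")
    case True
    then have "w i = 0" for i using less.prems[of i] unfolding J_def by (metis antisym_conv2 empty_iff mem_Collect_eq)
    then have "Min (w ` set is) = 0" if "length is = m" for "is"
      using that assms(2) by (intro Min_eqI) (auto simp: image_iff ex_in_conv)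
    then have "tensor_form m (\<lambda>is. Min (w ` set is)) = (\<lambda>x. 0)"
      by (auto simp: tensor_form_def fun_eq_iff)
    then show ?thesis by (simp add: sum_of_squares_const)
  next
    case False
    define d where "d = Min (w ` J)"
    define w' where "w' i = (if i \<in> J then w i - d else 0)" for i
    have d_le: "d \<le> w i" if "i \<in> J" for i using that by (auto simp: d_def)
    have "d \<in> w ` J"
      unfolding d_def by (rule Min_in) (use False in auto)
    then obtain i0 where i0: "i0 \<in> J" "w i0 = d" by blast
    then have "d > 0" by (auto simp: J_def)
    have w'_nonneg: "w' i \<ge> 0" for i using d_le by (auto simp: w'_def)
    \<comment> \<open>A minimiser drops out of the support, which makes the induction measure
      decrease.\<close>
    have "{i. w' i > 0} \<subset> J" using i0 by (auto simp: w'_def)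
    then have "card {i. w' i > 0} < card {i. w i > 0}"
      by (simp add: J_def psubset_card_mono)
    then have IH: "sum_of_squares (tensor_form m (\<lambda>is. Min (w' ` set is)))"
      using less.hyps w'_nonneg by blast
    have out: "w i = 0" "w' i = 0" if "i \<notin> J" for i
      using that less.prems[of i] by (simp_all add: J_def w'_def)
    have min: "Min (w ` set is) = (if set is \<subseteq> J then d else 0) + Min (w' ` set is)"
      if "length is = m" for "is"
    proof -
      have ne: "set is \<noteq> {}" using that assms(2) by auto
      show ?thesis
      proof (cases "set is \<subseteq> J")
        case True
        then have "w ` set is = (\<lambda>i. w' i + d) ` set is"
          by (intro image_cong refl) (auto simp: w'_def)
        then show ?thesis using True ne Min_add_commute[of "set is" w' d] by simp
      next
        case False
        then obtain i where "i \<in> set is" "i \<notin> J" by auto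
        then have "Min (w ` set is) = 0" "Min (w' ` set is) = 0"
          using out[of i] less.prems w'_nonneg by (auto intro!: Min_eqI image_eqI[of 0 _ i])
        then show ?thesis using False by simp
      qed
    qed
    have "tensor_form m (\<lambda>is. Min (w ` set is)) =
        (\<lambda>x. d * (\<Sum>i\<in>J. x $ i) ^ m + tensor_form m (\<lambda>is. Min (w' ` set is)) x)"
    proof
      fix x :: "real ^ 'n"
      have ind: "(\<Prod>i\<leftarrow>is. if i \<in> J then x $ i else 0) =
          (if set is \<subseteq> J then \<Prod>i\<leftarrow>is. x $ i else 0)" for "is"
        by (induction "is") auto
      have "(\<Sum>i\<in>J. x $ i) ^ m = (\<Sum>is | length is = m. \<Prod>i\<leftarrow>is. if i \<in> J then x $ i else 0)"
        unfolding sum_lists_prod_list by (simp add: sum.If_cases)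
      then have "d * (\<Sum>i\<in>J. x $ i) ^ m =
          (\<Sum>is | length is = m. (if set is \<subseteq> J then d else 0) * (\<Prod>i\<leftarrow>is. x $ i))"
        unfolding ind by (auto simp: sum_distrib_left intro!: sum.cong)
      then show "tensor_form m (\<lambda>is. Min (w ` set is)) x =
          d * (\<Sum>i\<in>J. x $ i) ^ m + tensor_form m (\<lambda>is. Min (w' ` set is)) x"
        by (simp add: tensor_form_def min distrib_right sum.distrib)
    qed
    moreover have "sum_of_squares (\<lambda>x. d * (\<Sum>i\<in>J. x $ i) ^ m +
        tensor_form m (\<lambda>is. Min (w' ` set is)) x)"
      using \<open>d > 0\<close> assms(1)
      by (intro sum_of_squares_add IH sum_of_squares_mult sum_of_squares_const
          sum_of_squares_even_power real_polynomial_function_sum real_polynomial_function_nth) simp_all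
    ultimately show ?thesis by simp
  qed
qed

subsection \<open>Symmetric Z-tensors with positive almost-eigenvectors\<close>

text \<open>The coordinates of the vector usually written Z x^(m-1), the left-hand side of the
  eigenvalue equation over the reals.\<close>

definition tensor_apply :: "nat \<Rightarrow> 'n::finite tensor \<Rightarrow> real ^ 'n \<Rightarrow> 'n \<Rightarrow> real" where
  "tensor_apply m z x i = (\<Sum>js | length js = m - 1. z (i # js) * (\<Prod>j\<leftarrow>js. x $ j))"

text \<open>\<open>w is k\<close> is the amount of the monomial \<open>x $ (is ! k) ^ m\<close> that
  is spent on the entry \<open>is\<close>. The condition \<open>prod\<close> makes each entry
  together with its share an AM-GM difference, and \<open>row\<close> says that no variable spends
  more than the available \<open>s\<close>; what is left over is a nonnegative combination of even
  powers.\<close>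

lemma sum_of_squares_of_weights:
  fixes z :: "'n::finite tensor"
  assumes "even m" "m > 0"
    and z: "\<And>is. length is = m \<Longrightarrow> z is \<ge> 0"
    and w: "\<And>is k. length is = m \<Longrightarrow> k < m \<Longrightarrow> w is k \<ge> 0"
    and prod: "\<And>is. length is = m \<Longrightarrow> (\<Prod>k<m. w is k) = (z is / m) ^ m"
    and row: "\<And>i. (\<Sum>is | length is = m. \<Sum>k | k < m \<and> is ! k = i. w is k) \<le> s"
  shows "sum_of_squares (\<lambda>x. s * (\<Sum>i\<in>UNIV. x $ i ^ m) - tensor_form m z x)"
proof -
  define r where "r i = (\<Sum>is | length is = m. \<Sum>k | k < m \<and> is ! k = i. w is k)" for i
  define D where "D is x = (\<Sum>k<m. w is k * (x $ (is ! k)) ^ m) - z is * (\<Prod>k<m. x $ (is ! k))"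
    for "is" and x :: "real ^ 'n"
  have "(\<lambda>x. s * (\<Sum>i\<in>UNIV. x $ i ^ m) - tensor_form m z x) =
      (\<lambda>x. (\<Sum>i\<in>UNIV. (s - r i) * x $ i ^ m) + (\<Sum>is | length is = m. D is x))"
  proof
    fix x :: "real ^ 'n"
    have "(\<Sum>i\<in>UNIV. r i * x $ i ^ m) =
        (\<Sum>i\<in>UNIV. \<Sum>is | length is = m. \<Sum>k | k < m \<and> is ! k = i. w is k * (x $ (is ! k)) ^ m)"
      by (simp add: r_def sum_distrib_right)
    also have "\<dots> =
        (\<Sum>is | length is = m. \<Sum>i\<in>UNIV. \<Sum>k | k < m \<and> is ! k = i. w is k * (x $ (is ! k)) ^ m)"
      by (rule sum.swap)
    also have "\<dots> = (\<Sum>is | length is = m. \<Sum>k<m. w is k * (x $ (is ! k)) ^ m)"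
    proof (intro sum.cong refl)
      fix "is" :: "'n list"
      show "(\<Sum>i\<in>UNIV. \<Sum>k | k < m \<and> is ! k = i. w is k * (x $ (is ! k)) ^ m) =
          (\<Sum>k<m. w is k * (x $ (is ! k)) ^ m)"
        using sum.group[of "{..<m}" "UNIV :: 'n set" "\<lambda>k. is ! k" "\<lambda>k. w is k * (x $ (is ! k)) ^ m"]
        by simp
    qed
    finally have "(\<Sum>i\<in>UNIV. r i * x $ i ^ m) =
        (\<Sum>is | length is = m. \<Sum>k<m. w is k * (x $ (is ! k)) ^ m)" .
    moreover have "tensor_form m z x = (\<Sum>is | length is = m. z is * (\<Prod>k<m. x $ (is ! k)))"
      by (simp add: tensor_form_def prod_list_map_nth)
    ultimately show "s * (\<Sum>i\<in>UNIV. x $ i ^ m) - tensor_form m z x =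
        (\<Sum>i\<in>UNIV. (s - r i) * x $ i ^ m) + (\<Sum>is | length is = m. D is x)"
      by (simp add: D_def sum_subtractf sum_distrib_left left_diff_distrib)
  qed
  moreover have "sum_of_squares (D is)" if "length is = m" for "is"
    unfolding D_def using assms that
    by (intro sum_of_squares_weighted_AM_GM real_polynomial_function_nth) simp_all
  moreover have "s - r i \<ge> 0" for i
    using row[of i] by (simp add: r_def)
  ultimately show ?thesis
    using assms(1)
    by (simp only:) (intro sum_of_squares_add sum_of_squares_sum sum_of_squares_mult
        sum_of_squares_const sum_of_squares_even_power real_polynomial_function_nth; simp)
qed

text \<open>Swapping the positions 0 and \<open>k\<close> is an involution that exchanges the two
  index sets and preserves \<open>g\<close>.\<close>

lemma sum_lists_nth_symmetric:
  fixes g :: "'n::finite list \<Rightarrow> real"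
  assumes "symmetric_tensor m g" "k < m"
  shows "(\<Sum>is | length is = m \<and> is ! k = i. g is) = (\<Sum>is | length is = m \<and> is ! 0 = i. g is)"
proof -
  define p where "p = Transposition.transpose 0 k"
  have p: "p permutes {..<m}"
    unfolding p_def using assms(2) by (intro permutes_swap_id) auto
  have inv: "permute_list p (permute_list p is) = is" if "length is = m" for "is" :: "'n list"
    using permute_list_compose[of p "is" p] p that by (simp add: p_def)
  have nth: "permute_list p is ! k = is ! 0" "permute_list p is ! 0 = is ! k"
    if "length is = m" for "is" :: "'n list"
    using that p assms(2) by (simp_all add: permute_list_nth p_def)
  show ?thesis
    by (rule sum.reindex_bij_witness[of _ "permute_list p" "permute_list p"])
       (use p inv nth assms(1) in \<open>auto simp: symmetric_tensor_def\<close>)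
qed

lemma permute_list_prod_list:
  assumes "p permutes {..<length is}"
  shows "(\<Prod>i\<leftarrow>permute_list p is. f i) = (\<Prod>i\<leftarrow>is. f i :: 'b::comm_monoid_mult)"
  using assms by (metis mset_map mset_permute_list prod_mset_prod_list)

text \<open>In the variables \<open>x $ i / y $ i\<close> the entry \<open>z is\<close> becomes
  \<open>g is\<close>. It is shared equally among its \<open>m\<close> positions, and undoing the
  scaling divides the share by \<open>y $ (is ! k) ^ m\<close>. These divisors cancel in the product
  of the weights, and the row sums become the quotients of \<open>tensor_apply m z y i\<close> by
  \<open>y $ i ^ (m - 1)\<close>.\<close>

lemma symmetric_weights:
  fixes z :: "'n::finite tensor" and y :: "real ^ 'n"
  assumes "m > 0" "symmetric_tensor m z" "\<And>is. length is = m \<Longrightarrow> z is \<ge> 0"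
    and y: "\<And>i. y $ i > 0" "\<And>i. tensor_apply m z y i \<le> s * y $ i ^ (m - 1)"
  obtains w where "\<And>is k. length is = m \<Longrightarrow> k < m \<Longrightarrow> w is k \<ge> 0"
    and "\<And>is. length is = m \<Longrightarrow> (\<Prod>k<m. w is k) = (z is / m) ^ m"
    and "\<And>i. (\<Sum>is | length is = m. \<Sum>k | k < m \<and> is ! k = i. w is k) \<le> s"
proof
  define g where "g is = z is * (\<Prod>i\<leftarrow>is. y $ i)" for "is"
  define w where "w is k = g is / (m * y $ (is ! k) ^ m)" for "is" and k :: nat
  have pos: "(\<Prod>i\<leftarrow>is. y $ i) > 0" for "is"
    by (induction "is") (simp_all add: y)
  show "w is k \<ge> 0" if "length is = m" "k < m" for "is" k
    using that assms(3)[of "is"] pos[of "is"] y(1)[of "is ! k"] by (simp add: w_def g_def)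
  show "(\<Prod>k<m. w is k) = (z is / m) ^ m" if "length is = m" for "is"
  proof -
    define P where "P = (\<Prod>i\<leftarrow>is. y $ i)"
    have "(\<Prod>k<m. y $ (is ! k) ^ m) = P ^ m"
      using that by (simp add: P_def prod_list_map_nth prod_power_distrib)
    moreover have "P \<noteq> 0" using pos[of "is"] by (simp add: P_def)
    ultimately show ?thesis
      by (simp add: w_def g_def prod_dividef prod.distrib P_def[symmetric] power_mult_distrib
          power_divide)
  qed
  show "(\<Sum>is | length is = m. \<Sum>k | k < m \<and> is ! k = i. w is k) \<le> s" for i
  proof -
    have sym: "symmetric_tensor m g"
      using assms(2) by (auto simp: symmetric_tensor_def g_def permute_list_prod_list)
    have "(\<Sum>is | length is = m. \<Sum>k | k < m \<and> is ! k = i. w is k) =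
        (\<Sum>is | length is = m. \<Sum>k<m. if is ! k = i then w is k else 0)"
      by (simp add: sum.inter_filter[symmetric])
    also have "\<dots> = (\<Sum>k<m. \<Sum>is | length is = m. if is ! k = i then w is k else 0)"
      by (rule sum.swap)
    also have "\<dots> = (\<Sum>k<m. \<Sum>is | length is = m \<and> is ! k = i. g is / (m * y $ i ^ m))"
      by (simp add: sum.inter_filter[symmetric]) (auto simp: w_def intro!: sum.cong)
    \<comment> \<open>By symmetry the inner sum does not depend on the position \<open>k\<close>;
      summing over the \<open>m\<close> positions then cancels the \<open>m\<close> in the
      weights.\<close>
    also have "\<dots> = (\<Sum>k<m. (\<Sum>is | length is = m \<and> is ! 0 = i. g is) / (m * y $ i ^ m))"
      unfolding sum_divide_distrib[symmetric]
      by (intro sum.cong refl arg_cong2[where f = "(/)"] sum_lists_nth_symmetric[OF sym]) simp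
    also have "\<dots> = (\<Sum>js | length js = m - 1. g (i # js)) / y $ i ^ m"
      using assms(1) by (simp add: sum_lists_of_length_hd)
    also have "(\<Sum>js | length js = m - 1. g (i # js)) = y $ i * tensor_apply m z y i"
      by (simp add: g_def tensor_apply_def sum_distrib_left mult_ac)
    also have "y $ i * tensor_apply m z y i / y $ i ^ m = tensor_apply m z y i / y $ i ^ (m - 1)"
      using assms(1) y(1)[of i] by (cases m) auto
    also have "\<dots> \<le> s"
      using y(1)[of i] y(2)[of i] by (simp add: divide_le_eq)
    finally show ?thesis .
  qed
qed

section \<open>Passing to the limit in the weights\<close>

text \<open>Bolzano-Weierstrass for one coordinate after another: each new coordinate costs a
  further subsequence, along which the earlier ones still converge.\<close>

lemma convergent_subsequence_pointwise:
  fixes f :: "nat \<Rightarrow> 'a \<Rightarrow> real"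
  assumes "finite F" "\<And>t. t \<in> F \<Longrightarrow> bounded (range (\<lambda>k. f k t))"
  obtains r l where "strict_mono r" "\<And>t. t \<in> F \<Longrightarrow> (\<lambda>k. f (r k) t) \<longlonglongrightarrow> l t"
proof -
  have "\<exists>r. strict_mono r \<and> (\<forall>t\<in>F. convergent (\<lambda>k. f (r k) t))"
    using assms
  proof (induction F rule: finite_induct)
    case empty
    show ?case by (auto intro: exI[of _ id] strict_mono_id)
  next
    case (insert t F)
    then obtain r where r: "strict_mono r" "\<forall>t\<in>F. convergent (\<lambda>k. f (r k) t)" by auto
    have "bounded (range (\<lambda>k. f (r k) t))"
      by (rule bounded_subset[OF insert.prems[of t]]) auto
    then obtain l q where q: "strict_mono q" "((\<lambda>k. f (r k) t) \<circ> q) \<longlonglongrightarrow> l"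
      using bounded_imp_convergent_subsequence by blast
    have "convergent (\<lambda>k. f ((r \<circ> q) k) u)" if "u \<in> F" for u
      using convergent_subseq_convergent[OF _ q(1), of "\<lambda>k. f (r k) u"] r(2) that
      by (simp add: o_def)
    moreover have "convergent (\<lambda>k. f ((r \<circ> q) k) t)"
      using q(2) by (auto simp: convergent_def o_def)
    ultimately show ?case
      by (intro exI[of _ "r \<circ> q"] conjI strict_mono_o[OF r(1) q(1)]) simp
  qed
  then obtain r where "strict_mono r" "\<forall>t\<in>F. convergent (\<lambda>k. f (r k) t)" by blast
  then show thesis
    by (intro that[of r "\<lambda>t. lim (\<lambda>k. f (r k) t)"]) (auto simp: convergent_LIMSEQ_iff)
qed

text \<open>A nonnegative eigenvector may have zero coordinates, by which the weights cannot be
  divided, and the values \<open>s k\<close> of the positive vectors may exceed \<open>c\<close>.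
  The limit is therefore taken in the weights: they stay bounded, and all conditions on them are
  closed.\<close>

lemma sum_of_squares_symmetric_Z_tensor:
  fixes z :: "'n::finite tensor" and y :: "nat \<Rightarrow> real ^ 'n"
  assumes "even m" "m > 0" "symmetric_tensor m z" and z: "\<And>is. length is = m \<Longrightarrow> z is \<ge> 0"
    and y: "\<And>k i. y k $ i > 0" "\<And>k i. tensor_apply m z (y k) i \<le> s k * y k $ i ^ (m - 1)"
    and s: "s \<longlonglongrightarrow> lam" "lam \<le> c"
  shows "sum_of_squares (\<lambda>x. c * (\<Sum>i\<in>UNIV. x $ i ^ m) - tensor_form m z x)"
proof -
  define good where "good k w \<longleftrightarrow> (\<forall>is l. length is = m \<longrightarrow> l < m \<longrightarrow> w is l \<ge> 0) \<and>
      (\<forall>is. length is = m \<longrightarrow> (\<Prod>l<m. w is l) = (z is / m) ^ m) \<and>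
      (\<forall>i. (\<Sum>is | length is = m. \<Sum>l | l < m \<and> is ! l = i. w is l) \<le> s k)"
    for k and w :: "'n list \<Rightarrow> nat \<Rightarrow> real"
  have "\<exists>w. good k w" for k
  proof (rule symmetric_weights[OF assms(2,3) z y(1)[of k] y(2)[of k]])
    fix w :: "'n list \<Rightarrow> nat \<Rightarrow> real"
    assume "\<And>is l. length is = m \<Longrightarrow> l < m \<Longrightarrow> w is l \<ge> 0"
      "\<And>is. length is = m \<Longrightarrow> (\<Prod>l<m. w is l) = (z is / m) ^ m"
      "\<And>i. (\<Sum>is | length is = m. \<Sum>l | l < m \<and> is ! l = i. w is l) \<le> s k"
    then show "\<exists>w. good k w" by (intro exI[of _ w]) (simp add: good_def)
  qed
  then obtain w where "good k (w k)" for k by metis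
  then have w: "\<And>k is l. length is = m \<Longrightarrow> l < m \<Longrightarrow> w k is l \<ge> 0"
      "\<And>k is. length is = m \<Longrightarrow> (\<Prod>l<m. w k is l) = (z is / m) ^ m"
      "\<And>k i. (\<Sum>is | length is = m. \<Sum>l | l < m \<and> is ! l = i. w k is l) \<le> s k"
    by (auto simp: good_def)
  \<comment> \<open>A weight is one of the nonnegative terms of the row sum for the index
    \<open>is ! l\<close>.\<close>
  have w_le: "w k is l \<le> s k" if "length is = m" "l < m" for k "is" l
  proof -
    have "w k is l \<le> (\<Sum>l' | l' < m \<and> is ! l' = is ! l. w k is l')"
      using that w(1) by (intro member_le_sum) auto
    also have "\<dots> \<le> (\<Sum>is' | length is' = m. \<Sum>l' | l' < m \<and> is' ! l' = is ! l. w k is' l')"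
      using that w(1)
      by (intro member_le_sum[where f = "\<lambda>is'. \<Sum>l' | l' < m \<and> is' ! l' = is ! l. w k is' l'"] sum_nonneg)
         auto
    finally show ?thesis using w(3)[of k "is ! l"] by simp
  qed
  have bs: "bounded (range s)"
    using s(1) convergent_imp_bounded by blast
  have bnd: "bounded (range (\<lambda>k. case t of (is, l) \<Rightarrow> w k is l))"
    if "t \<in> {is. length is = m} \<times> {..<m}" for t
  proof -
    obtain K where K: "\<And>k. \<bar>s k\<bar> \<le> K" using bs by (auto simp: bounded_iff)
    have "\<bar>w k (fst t) (snd t)\<bar> \<le> K" for k
      using that w(1)[of "fst t" "snd t" k] w_le[of "fst t" "snd t" k] K[of k] by auto
    then show ?thesis by (auto simp: bounded_iff case_prod_unfold)
  qed
  have fin: "finite ({is :: 'n list. length is = m} \<times> {..<m})" by simp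
  obtain r v' where r: "strict_mono r"
    and v': "\<And>t. t \<in> {is. length is = m} \<times> {..<m} \<Longrightarrow>
      (\<lambda>k. case t of (is, l) \<Rightarrow> w (r k) is l) \<longlonglongrightarrow> v' t"
  proof (rule convergent_subsequence_pointwise[OF fin bnd])
    fix r and l :: "'n list \<times> nat \<Rightarrow> real"
    assume "strict_mono r" "\<And>t. t \<in> {is. length is = m} \<times> {..<m} \<Longrightarrow>
      (\<lambda>k. case t of (is, l) \<Rightarrow> w (r k) is l) \<longlonglongrightarrow> l t"
    then show thesis by (rule that)
  qed
  define v where "v is l = v' (is, l)" for "is" l
  have v: "(\<lambda>k. w (r k) is l) \<longlonglongrightarrow> v is l" if "length is = m" "l < m" for "is" l
    using v'[of "(is, l)"] that by (simp add: v_def)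
  show ?thesis
  proof (rule sum_of_squares_of_weights[OF assms(1,2) z])
    show "v is l \<ge> 0" if "length is = m" "l < m" for "is" l
      using v[OF that] w(1)[OF that] by (intro LIMSEQ_le_const) auto
    show "(\<Prod>l<m. v is l) = (z is / m) ^ m" if "length is = m" for "is"
    proof (rule LIMSEQ_unique)
      show "(\<lambda>k. \<Prod>l<m. w (r k) is l) \<longlonglongrightarrow> (\<Prod>l<m. v is l)"
        using v[OF that] by (intro tendsto_prod) auto
      show "(\<lambda>k. \<Prod>l<m. w (r k) is l) \<longlonglongrightarrow> (z is / m) ^ m"
        by (simp add: w(2)[OF that])
    qed
    show "(\<Sum>is | length is = m. \<Sum>l | l < m \<and> is ! l = i. v is l) \<le> c" for i
    proof (rule order_trans[OF _ s(2)], rule LIMSEQ_le)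
      show "(\<lambda>k. \<Sum>is | length is = m. \<Sum>l | l < m \<and> is ! l = i. w (r k) is l) \<longlonglongrightarrow>
          (\<Sum>is | length is = m. \<Sum>l | l < m \<and> is ! l = i. v is l)"
        using v by (intro tendsto_sum) auto
      show "(\<lambda>k. s (r k)) \<longlonglongrightarrow> lam"
        using LIMSEQ_subseq_LIMSEQ[OF s(1) r] by (simp add: o_def)
    qed (use w(3) in auto)
  qed
qed

subsection \<open>Perron--Frobenius for nonnegative tensors\<close>

lemma continuous_on_tensor_apply: "continuous_on S (\<lambda>x. tensor_apply m z x i)"
proof -
  have "continuous_on S (\<lambda>x :: real ^ 'a. \<Prod>j\<leftarrow>js. x $ j)" for js
    by (induction js) (auto intro!: continuous_intros)
  then show ?thesis
    unfolding tensor_apply_def by (intro continuous_intros)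
qed

lemma tensor_apply_nonneg:
  assumes "m > 0" "\<And>is. length is = m \<Longrightarrow> z is \<ge> 0" "\<And>i. x $ i \<ge> 0"
  shows "tensor_apply m z x i \<ge> 0"
  unfolding tensor_apply_def
  by (intro sum_nonneg mult_nonneg_nonneg) (use assms in \<open>auto intro!: prod_list_nonneg\<close>)

text \<open>Perron--Frobenius by Brouwer's theorem: fixed points of the normalised maps
  \<open>x \<mapsto> (Z x^(m-1))^(1/(m-1)) + \<epsilon>\<close> on the simplex are positive almost-eigenvectors,
  and they accumulate at a nonnegative eigenvector as \<open>\<epsilon> \<longlonglongrightarrow> 0\<close>.\<close>

lemma nonneg_tensor_Perron_sequence:
  fixes z :: "'n::finite tensor"
  assumes "m \<ge> 2" and z: "\<And>is. length is = m \<Longrightarrow> z is \<ge> 0"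
  obtains lam :: real and x :: "real ^ 'n" and y :: "nat \<Rightarrow> real ^ 'n" and s :: "nat \<Rightarrow> real"
  where "x \<noteq> 0" "\<And>i. x $ i \<ge> 0" "\<And>i. tensor_apply m z x i = lam * x $ i ^ (m - 1)"
    and "\<And>k i. y k $ i > 0" "\<And>k i. tensor_apply m z (y k) i \<le> s k * y k $ i ^ (m - 1)"
    and "s \<longlonglongrightarrow> lam"
proof -
  define N where "N = m - 1"
  have N: "N > 0" "m > 0" using assms(1) by (auto simp: N_def)
  \<comment> \<open>Taking the root turns the eigenvalue equation into
    \<open>T x i = mu * x $ i\<close>, where the eigenvalue is \<open>mu ^ N\<close>.\<close>
  define T where "T x i = root N (tensor_apply m z x i)" for x i
  define S :: "(real ^ 'n) set" where "S = {x. (\<forall>i. 0 \<le> x $ i) \<and> (\<Sum>i\<in>UNIV. x $ i) = 1}"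
  have T_nonneg: "T x i \<ge> 0" if "x \<in> S" for x i
    using tensor_apply_nonneg[of m z x i] z that N by (auto simp: T_def S_def)
  have T_pow: "T x i ^ N = tensor_apply m z x i" if "x \<in> S" for x i
    using tensor_apply_nonneg[of m z x i] z that N by (auto simp: T_def S_def)
  have T_cont: "continuous_on A (\<lambda>x. T x i)" for A i
    unfolding T_def by (intro continuous_on_real_root continuous_on_tensor_apply)
  have "x $ i \<le> 1" if "x \<in> S" for x i
    using that member_le_sum[of i UNIV "\<lambda>i. x $ i"] by (auto simp: S_def)
  then have "S \<subseteq> cbox 0 1" by (auto simp: S_def mem_box_cart)
  then have "bounded S" using bounded_cbox bounded_subset by blast
  moreover have "closed S"
    unfolding S_def
    by (intro closed_Collect_conj closed_Collect_all closed_Collect_le closed_Collect_eq continuous_intros)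
  ultimately have compact: "compact S" by (simp add: compact_eq_bounded_closed)
  have convex: "convex S"
    by (rule convexI) (auto simp: S_def sum.distrib sum_distrib_left[symmetric])
  have "axis undefined 1 \<in> S" by (auto simp: S_def axis_def)
  then have ne: "S \<noteq> {}" by blast
  have "\<exists>x\<in>S. \<forall>i. T x i + e = (\<Sum>j\<in>UNIV. T x j + e) * x $ i" if "e > 0" for e :: real
  proof -
    \<comment> \<open>The shift by \<open>e\<close> keeps the denominator positive even where
      \<open>T\<close> vanishes; dividing by it brings the image back into the simplex.\<close>
    define F where "F x = (\<chi> i. (T x i + e) / (\<Sum>j\<in>UNIV. T x j + e))" for x
    have pos: "(\<Sum>j\<in>UNIV. T x j + e) > 0" if "x \<in> S" for x
      using T_nonneg[OF that] \<open>e > 0\<close> by (intro sum_pos) (auto simp: add_nonneg_pos)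
    have "continuous_on S F"
      unfolding F_def using pos
      by (intro continuous_on_vec_lambda continuous_intros T_cont) force
    moreover have "F ` S \<subseteq> S"
    proof safe
      fix x assume x: "x \<in> S"
      have "0 \<le> F x $ i" for i
        using pos[OF x] T_nonneg[OF x, of i] \<open>e > 0\<close> by (simp add: F_def)
      moreover have "(\<Sum>i\<in>UNIV. F x $ i) = 1"
        using pos[OF x] by (simp add: F_def sum_divide_distrib[symmetric])
      ultimately show "F x \<in> S" by (simp add: S_def)
    qed
    ultimately obtain x where x: "x \<in> S" "F x = x"
      using brouwer[OF compact convex ne] by blast
    have "T x i + e = (\<Sum>j\<in>UNIV. T x j + e) * x $ i" for i
    proof -
      have "x $ i = (T x i + e) / (\<Sum>j\<in>UNIV. T x j + e)"
        using arg_cong[OF x(2), of "\<lambda>v. v $ i"] by (simp add: F_def)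
      then show ?thesis using pos[OF x(1)] by (metis less_irrefl nonzero_eq_divide_eq mult.commute)
    qed
    with x(1) show ?thesis by blast
  qed
  then have "\<exists>x\<in>S. \<forall>i. T x i + inverse (real (Suc k)) =
      (\<Sum>j\<in>UNIV. T x j + inverse (real (Suc k))) * x $ i" for k
    by simp
  then obtain y where y: "y k \<in> S"
    "T (y k) i + inverse (real (Suc k)) = (\<Sum>j\<in>UNIV. T (y k) j + inverse (real (Suc k))) * y k $ i"
    for k i
    by metis
  define M where "M k = (\<Sum>j\<in>UNIV. T (y k) j + inverse (real (Suc k)))" for k
  have y_eq: "T (y k) i + inverse (real (Suc k)) = M k * y k $ i" for k i
    unfolding M_def by (rule y(2))
  obtain x r where x: "x \<in> S" and r: "strict_mono r" and lim: "(y \<circ> r) \<longlonglongrightarrow> x"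
    using compact y(1) unfolding compact_def by metis
  have T_lim: "(\<lambda>k. T (y (r k)) i) \<longlonglongrightarrow> T x i" for i
    using continuous_on_tendsto_compose[OF T_cont[of UNIV i] lim] by (simp add: o_def)
  have inv_lim: "(\<lambda>k. inverse (real (Suc (r k)))) \<longlonglongrightarrow> 0"
    using LIMSEQ_subseq_LIMSEQ[OF LIMSEQ_inverse_real_of_nat r] by (simp add: o_def)
  define mu where "mu = (\<Sum>j\<in>UNIV. T x j)"
  have "(\<lambda>k. M (r k)) \<longlonglongrightarrow> (\<Sum>j\<in>UNIV. T x j + 0)"
    unfolding M_def by (intro tendsto_sum tendsto_add T_lim inv_lim)
  then have M_lim: "(\<lambda>k. M (r k)) \<longlonglongrightarrow> mu" by (simp add: mu_def)
  have eig: "T x i = mu * x $ i" for i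
  proof (rule LIMSEQ_unique)
    have "(\<lambda>k. T (y (r k)) i + inverse (real (Suc (r k)))) \<longlonglongrightarrow> T x i + 0"
      by (intro tendsto_add T_lim inv_lim)
    then show "(\<lambda>k. M (r k) * y (r k) $ i) \<longlonglongrightarrow> T x i"
      by (simp only: y_eq add_0_right)
    show "(\<lambda>k. M (r k) * y (r k) $ i) \<longlonglongrightarrow> mu * x $ i"
      using tendsto_vec_nth[OF lim] by (intro tendsto_mult M_lim) (simp add: o_def)
  qed
  have y_pos: "y k $ i > 0" and M_nonneg: "M k \<ge> 0" for k i
  proof -
    show M: "M k \<ge> 0"
      unfolding M_def using T_nonneg[OF y(1)[of k]] by (intro sum_nonneg) simp
    have "0 < T (y k) i + inverse (real (Suc k))"
      using T_nonneg[OF y(1)[of k], of i] by (simp add: add_nonneg_pos)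
    also have "\<dots> = M k * y k $ i" by (rule y_eq)
    finally show "y k $ i > 0" using M by (simp add: zero_less_mult_iff)
  qed
  show thesis
  proof (rule that[of x "mu ^ N" "\<lambda>k. y (r k)" "\<lambda>k. M (r k) ^ N"])
    show "x \<noteq> 0" "x $ i \<ge> 0" for i using x by (auto simp: S_def)
    show "tensor_apply m z x i = mu ^ N * x $ i ^ (m - 1)" for i
      using T_pow[OF x, of i] by (simp add: eig power_mult_distrib N_def)
    show "y (r k) $ i > 0" for k i by (rule y_pos)
    show "(\<lambda>k. M (r k) ^ N) \<longlonglongrightarrow> mu ^ N" by (intro tendsto_power M_lim)
    show "tensor_apply m z (y (r k)) i \<le> M (r k) ^ N * y (r k) $ i ^ (m - 1)" for k i
    proof -
      \<comment> \<open>Dropping the shift turns the fixed point equation into the required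
        inequality.\<close>
      have "T (y (r k)) i \<le> T (y (r k)) i + inverse (real (Suc (r k)))" by simp
      also have "\<dots> = M (r k) * y (r k) $ i" by (rule y_eq)
      finally have "T (y (r k)) i ^ N \<le> (M (r k) * y (r k) $ i) ^ N"
        using T_nonneg[OF y(1)] by (intro power_mono)
      then show ?thesis unfolding N_def[symmetric] by (simp only: T_pow[OF y(1)] power_mult_distrib)
    qed
  qed
qed

subsection \<open>The three classes of tensors\<close>

lemma offdiag_finite [simp]: "finite (offdiag m (i :: 'n::finite))"
  by (rule finite_subset[of _ "{js. length js = m - 1}"]) (auto simp: offdiag_def)

lemma tensor_beta_nonneg: "tensor_beta m b i \<ge> 0"
  by (simp add: tensor_beta_def)

lemma tensor_beta_ge:
  assumes "js \<in> offdiag m i"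
  shows "b (i # js) \<le> tensor_beta m b i"
  using assms unfolding tensor_beta_def by (intro Max_ge) auto

lemma identity_tensor_Cons:
  assumes "m > 0" "length js = m - 1"
  shows "identity_tensor m (i # js) = (if js = replicate (m - 1) i then 1 else 0)"
proof -
  obtain N where "m = Suc N" using assms(1) by (cases m) auto
  then show ?thesis using assms(2) by (auto simp: identity_tensor_def)
qed

text \<open>By symmetry an off-diagonal entry occurs in the row of each of its indices: a swap
  brings \<open>j\<close> to the front, and the entry then competes in the maximum for row
  \<open>j\<close>.\<close>

lemma symmetric_tensor_le_tensor_beta:
  fixes b :: "'n::finite tensor"
  assumes "symmetric_tensor m b" "length is = m" "identity_tensor m is = 0" "j \<in> set is"
  shows "b is \<le> tensor_beta m b j"
proof -
  obtain k where k: "k < m" "is ! k = j" using assms(2,4) by (auto simp: in_set_conv_nth)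
  define p where "p = Transposition.transpose 0 k"
  have p: "p permutes {..<m}"
    unfolding p_def using k by (intro permutes_swap_id) auto
  define js where "js = permute_list p is"
  have len: "length js = m" by (simp add: js_def assms(2))
  have "b js = b is" using assms(1,2) p by (simp add: symmetric_tensor_def js_def)
  have "js ! 0 = j" using k p assms(2) by (simp add: js_def permute_list_nth p_def)
  then obtain ks where ks: "js = j # ks" "length ks = m - 1"
    using len k(1) by (cases js) auto
  \<comment> \<open>The swap keeps the set of indices, so a constant list could only come from a
    diagonal one.\<close>
  have "ks \<noteq> replicate (m - 1) j"
  proof
    assume "ks = replicate (m - 1) j"
    then have "set js = {j}" using ks by auto
    then have "set is = {j}" using p assms(2) by (simp add: js_def)
    then have "is = replicate m j"
      using assms(2) by (metis replicate_eqI singletonD)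
    then show False using assms(3) by (auto simp: identity_tensor_def)
  qed
  then have "ks \<in> offdiag m j" using ks by (simp add: offdiag_def)
  then show ?thesis using tensor_beta_ge \<open>b js = b is\<close> ks(1) by metis
qed

lemma tensor_form_identity:
  assumes "m > 0"
  shows "tensor_form m (identity_tensor m) x = (\<Sum>i\<in>UNIV. x $ i ^ m)"
proof -
  have "tensor_form m (identity_tensor m) x =
      (\<Sum>is\<in>range (\<lambda>i. replicate m i). \<Prod>i\<leftarrow>is. x $ i)"
    unfolding tensor_form_def
    by (rule sum.mono_neutral_cong_right) (auto simp: identity_tensor_def)
  also have "\<dots> = (\<Sum>i\<in>UNIV. x $ i ^ m)"
    using assms by (subst sum.reindex) (auto simp: inj_on_def replicate_eq_replicate prod_list_replicate)
  finally show ?thesis .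
qed

text \<open>The common core of the three cases. The tensor \<open>z\<close> can fail to be
  symmetric, because \<beta> is taken at the first index. The Perron vectors are therefore found for
  \<open>z\<close> and then used for the symmetric \<open>z'\<close> below it, while
  \<open>eig\<close> is applied to the nonnegative eigenvector that comes with them.\<close>

lemma has_SOS_decomposition_if_eigenvalues_le:
  fixes b z :: "'n::finite tensor"
  assumes "even m" "m > 0" "symmetric_tensor m b"
    and z: "\<And>is. length is = m \<Longrightarrow> z is \<ge> 0"
    and bz: "\<And>is. length is = m \<Longrightarrow> b is - tensor_beta m b (hd is) = s * identity_tensor m is - z is"
    and eig: "\<And>lam x. x \<noteq> 0 \<Longrightarrow> (\<And>i. x $ i \<ge> 0) \<Longrightarrow>
      (\<And>i. tensor_apply m z x i = lam * x $ i ^ (m - 1)) \<Longrightarrow> lam \<le> s"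
  shows "has_SOS_decomposition m b"
proof -
  have "m \<ge> 2" using assms(1,2) by presburger
  define c where "c is = Min (tensor_beta m b ` set is)" for "is"
  define z' where "z' is = s * identity_tensor m is - b is + c is" for "is"
  have c_le: "c is \<le> tensor_beta m b i" if "i \<in> set is" for i "is"
    using that by (simp add: c_def)
  have z'_le: "z' is \<le> z is" if "length is = m" for "is"
  proof -
    have "hd is \<in> set is" using that assms(2) by auto
    then show ?thesis using c_le[of "hd is" "is"] bz[OF that] by (simp add: z'_def)
  qed
  have z'_nonneg: "z' is \<ge> 0" if "length is = m" for "is"
  proof (cases "\<exists>i. is = replicate m i")
    case True
    then obtain i where i: "is = replicate m i" by blast
    then have "c is = tensor_beta m b (hd is)" using assms(2) by (simp add: c_def)
    then have "z' is = z is" using bz[OF that] by (simp add: z'_def)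
    then show ?thesis using z[OF that] by simp
  next
    case False
    then have 0: "identity_tensor m is = 0" by (auto simp: identity_tensor_def)
    have "b is \<le> c is"
      unfolding c_def using symmetric_tensor_le_tensor_beta[OF assms(3) that 0] that assms(2)
      by (subst Min_ge_iff) auto
    then show ?thesis by (simp add: z'_def 0)
  qed
  have "symmetric_tensor m z'"
    unfolding symmetric_tensor_def
  proof (intro allI impI)
    fix "is" :: "'n list" and p
    assume len: "length is = m" and p: "p permutes {..<m}"
    \<comment> \<open>A permutation keeps the set of indices; this gives the invariance of the
      diagonal, and that of \<open>c\<close> as well.\<close>
    have id: "(permute_list p is = replicate m i) = (is = replicate m i)" for i
      using p len by (metis length_permute_list replicate_eqI set_permute_list in_set_replicate)
    show "z' (permute_list p is) = z' is"
      using assms(3) len p by (simp add: z'_def c_def symmetric_tensor_def identity_tensor_def id)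
  qed
  obtain lam x y s' where x: "x \<noteq> 0" "\<And>i. x $ i \<ge> 0"
      "\<And>i. tensor_apply m z x i = lam * x $ i ^ (m - 1)"
    and y: "\<And>k i. y k $ i > (0::real)"
      "\<And>k i. tensor_apply m z (y k) i \<le> s' k * y k $ i ^ (m - 1)"
    and s': "s' \<longlonglongrightarrow> lam"
  proof (rule nonneg_tensor_Perron_sequence[OF \<open>m \<ge> 2\<close> z])
    fix lam x y s'
    assume "x \<noteq> 0" "\<And>i. x $ i \<ge> 0" "\<And>i. tensor_apply m z x i = lam * x $ i ^ (m - 1)"
      "\<And>k i. y k $ i > (0::real)"
      "\<And>k i. tensor_apply m z (y k) i \<le> s' k * y k $ i ^ (m - 1)"
      "s' \<longlonglongrightarrow> lam"
    then show thesis by (rule that)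
  qed
  \<comment> \<open>At positive vectors the entrywise bound \<open>z' \<le> z\<close> carries over,
    so the inequalities for \<open>z\<close> hold for \<open>z'\<close> with the same
    \<open>s'\<close>.\<close>
  have "tensor_apply m z' (y k) i \<le> tensor_apply m z (y k) i" for k i
    unfolding tensor_apply_def using assms(2) y(1)
    by (intro sum_mono mult_right_mono z'_le) (auto intro!: prod_list_nonneg simp: less_imp_le)
  then have y': "tensor_apply m z' (y k) i \<le> s' k * y k $ i ^ (m - 1)" for k i
    using y(2)[of k i] by (rule order_trans)
  have "sum_of_squares (\<lambda>x. s * (\<Sum>i\<in>UNIV. x $ i ^ m) - tensor_form m z' x)"
    by (rule sum_of_squares_symmetric_Z_tensor
        [OF assms(1,2) \<open>symmetric_tensor m z'\<close> z'_nonneg y(1) y' s' eig[OF x]])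
  then have "sum_of_squares (\<lambda>x. (s * (\<Sum>i\<in>UNIV. x $ i ^ m) - tensor_form m z' x) + tensor_form m c x)"
    unfolding c_def
    by (intro sum_of_squares_add sum_of_squares_Min_tensor assms(1,2) tensor_beta_nonneg)
  moreover have "tensor_form m b =
      (\<lambda>x. (s * (\<Sum>i\<in>UNIV. x $ i ^ m) - tensor_form m z' x) + tensor_form m c x)"
  proof
    fix x
    have "tensor_form m z' x =
        s * tensor_form m (identity_tensor m) x - tensor_form m b x + tensor_form m c x"
      by (simp add: tensor_form_def z'_def distrib_right left_diff_distrib sum.distrib
          sum_subtractf sum_distrib_left mult.assoc)
    then show "tensor_form m b x =
        (s * (\<Sum>i\<in>UNIV. x $ i ^ m) - tensor_form m z' x) + tensor_form m c x"
      by (simp add: tensor_form_identity assms(2))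
  qed
  ultimately show ?thesis by (simp add: has_SOS_decomposition_def)
qed

section \<open>The spectral radius and the MB0 case\<close>

text \<open>Row estimate at a coordinate of largest modulus. It bounds the set of eigenvalues,
  without which the supremum in \<open>tensor_spectral_radius\<close> would say nothing about its
  members.\<close>

lemma tensor_eigenvalue_norm_le:
  fixes z :: "'n::finite tensor"
  assumes "tensor_eigenvalue m z ev"
  shows "cmod ev \<le> (\<Sum>i\<in>UNIV. \<Sum>js | length js = m - 1. \<bar>z (i # js)\<bar>)"
proof -
  obtain x :: "complex ^ 'n" where x: "x \<noteq> 0"
    "\<And>i. (\<Sum>js | length js = m - 1. of_real (z (i # js)) * (\<Prod>j\<leftarrow>js. x $ j)) = ev * (x $ i) ^ (m - 1)"
    using assms by (auto simp: tensor_eigenvalue_def)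
  define X where "X = Max (range (\<lambda>i. cmod (x $ i)))"
  have X: "cmod (x $ i) \<le> X" for i by (simp add: X_def)
  have "X \<in> range (\<lambda>i. cmod (x $ i))" unfolding X_def by (rule Max_in) auto
  then obtain i where i: "X = cmod (x $ i)" by blast
  have "X > 0"
  proof -
    obtain j where "x $ j \<noteq> 0" using x(1) by (auto simp: vec_eq_iff)
    then show ?thesis using X[of j] by (meson less_le_trans zero_less_norm_iff)
  qed
  have prod: "cmod (\<Prod>j\<leftarrow>js. x $ j) \<le> X ^ length js" for js
  proof (induction js)
    case (Cons j js)
    then show ?case
      using X[of j] \<open>X > 0\<close> by (simp add: norm_mult mult_mono)
  qed simp
  have "cmod ev * X ^ (m - 1) = cmod (\<Sum>js | length js = m - 1. of_real (z (i # js)) * (\<Prod>j\<leftarrow>js. x $ j))"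
    unfolding x(2) by (simp add: norm_mult norm_power i)
  also have "\<dots> \<le> (\<Sum>js | length js = m - 1. \<bar>z (i # js)\<bar> * X ^ (m - 1))"
  proof (rule sum_norm_le)
    fix js :: "'n list" assume "js \<in> {js. length js = m - 1}"
    then show "cmod (of_real (z (i # js)) * (\<Prod>j\<leftarrow>js. x $ j)) \<le> \<bar>z (i # js)\<bar> * X ^ (m - 1)"
      using prod[of js] by (simp add: norm_mult mult_left_mono)
  qed
  finally have "cmod ev \<le> (\<Sum>js | length js = m - 1. \<bar>z (i # js)\<bar>)"
    using \<open>X > 0\<close> by (simp add: sum_distrib_right[symmetric])
  also have "\<dots> \<le> (\<Sum>i\<in>UNIV. \<Sum>js | length js = m - 1. \<bar>z (i # js)\<bar>)"
    by (rule member_le_sum[where f = "\<lambda>i. \<Sum>js | length js = m - 1. \<bar>z (i # js)\<bar>"])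
       (auto intro: sum_nonneg)
  finally show ?thesis .
qed

lemma tensor_eigenvalue_le_spectral_radius:
  assumes "tensor_eigenvalue m z ev"
  shows "cmod ev \<le> tensor_spectral_radius m z"
  unfolding tensor_spectral_radius_def
  by (rule cSUP_upper)
     (use assms tensor_eigenvalue_norm_le in \<open>auto intro!: bdd_aboveI2\<close>)

lemma tensor_eigenvalue_of_real:
  fixes x :: "real ^ 'n::finite"
  assumes "x \<noteq> 0" "\<And>i. tensor_apply m z x i = lam * x $ i ^ (m - 1)"
  shows "tensor_eigenvalue m z (of_real lam)"
proof -
  define u :: "complex ^ 'n" where "u = (\<chi> i. of_real (x $ i))"
  have "(\<Prod>j\<leftarrow>js. u $ j) = of_real (\<Prod>j\<leftarrow>js. x $ j)" for js
    by (induction js) (simp_all add: u_def)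
  then have "(\<Sum>js | length js = m - 1. of_real (z (i # js)) * (\<Prod>j\<leftarrow>js. u $ j)) =
      of_real (tensor_apply m z x i)" for i
    by (simp add: tensor_apply_def)
  then have "(\<Sum>js | length js = m - 1. of_real (z (i # js)) * (\<Prod>j\<leftarrow>js. u $ j)) =
      of_real lam * (u $ i) ^ (m - 1)" for i
    by (simp add: assms(2) u_def)
  moreover have "u \<noteq> 0" using assms(1) by (auto simp: u_def vec_eq_iff)
  ultimately show ?thesis unfolding tensor_eigenvalue_def by blast
qed

text \<open>The splitting in the definition of an M-tensor already has the shape that the criterion
  asks for, and a real eigenpair is in particular a complex one, so the spectral radius bounds
  it.\<close>

lemma has_SOS_decomposition_MB0:
  fixes b :: "'n::finite tensor"
  assumes "even m" "m > 0" "symmetric_tensor m b" "MB0_tensor m b"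
  shows "has_SOS_decomposition m b"
proof -
  obtain s z where z: "\<And>is. length is = m \<Longrightarrow> z is \<ge> 0"
    "\<And>is. length is = m \<Longrightarrow> b is - tensor_beta m b (hd is) = s * identity_tensor m is - z is"
    "s \<ge> tensor_spectral_radius m z"
    using assms(4) unfolding MB0_tensor_def M_tensor_def by blast
  show ?thesis
  proof (rule has_SOS_decomposition_if_eigenvalues_le[OF assms(1-3) z(1,2)])
    fix lam and x :: "real ^ 'n"
    assume "x \<noteq> 0" "\<And>i. tensor_apply m z x i = lam * x $ i ^ (m - 1)"
    then have "cmod (of_real lam) \<le> tensor_spectral_radius m z"
      by (intro tensor_eigenvalue_le_spectral_radius tensor_eigenvalue_of_real)
    then show "lam \<le> s" using z(3) by simp
  qed
qed

text \<open>The equation in \<open>no_eig\<close> says that \<open>x\<close> is an eigenvector of \<open>s I - (b - \<beta>)\<close> with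
  eigenvalue \<open>s + d\<close>.\<close>

lemma has_SOS_decomposition_if_no_eigenvector:
  fixes b :: "'n::finite tensor"
  assumes "even m" "m > 0" "symmetric_tensor m b"
    and diag: "\<And>i. b (replicate m i) > tensor_beta m b i"
    and no_eig: "\<And>d x. d > 0 \<Longrightarrow> x \<noteq> 0 \<Longrightarrow> (\<And>i. x $ i \<ge> 0) \<Longrightarrow>
      (\<And>i. (b (replicate m i) - tensor_beta m b i + d) * x $ i ^ (m - 1) =
        (\<Sum>js\<in>offdiag m i. (tensor_beta m b i - b (i # js)) * (\<Prod>j\<leftarrow>js. x $ j))) \<Longrightarrow> False"
  shows "has_SOS_decomposition m b"
proof -
  \<comment> \<open>By \<open>diag\<close> all summands are positive, so \<open>s\<close> dominates
    each of them and the diagonal of \<open>z\<close> is nonnegative.\<close>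
  define s where "s = (\<Sum>i\<in>UNIV. b (replicate m i) - tensor_beta m b i)"
  define z where "z is = s * identity_tensor m is - (b is - tensor_beta m b (hd is))" for "is"
  have z_diag: "z (i # replicate (m - 1) i) = s - (b (replicate m i) - tensor_beta m b i)" for i
  proof -
    have "i # replicate (m - 1) i = replicate m i" using assms(2) by (cases m) auto
    moreover have "identity_tensor m (replicate m i) = 1" by (auto simp: identity_tensor_def)
    ultimately show ?thesis using assms(2) by (simp add: z_def)
  qed
  have z_off: "z (i # js) = tensor_beta m b i - b (i # js)" if "js \<in> offdiag m i" for i js
    using that assms(2) by (simp add: z_def offdiag_def identity_tensor_Cons)
  have z_nonneg: "z is \<ge> 0" if len: "length is = m" for "is"
  proof -
    obtain i js where "is": "is = i # js" using len assms(2) by (cases "is") auto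
    show ?thesis
    proof (cases "js \<in> offdiag m i")
      case True
      then show ?thesis using z_off[OF True] tensor_beta_ge[OF True, of b] "is" by simp
    next
      case False
      then have "js = replicate (m - 1) i" using len "is" by (auto simp: offdiag_def)
      moreover have "b (replicate m i) - tensor_beta m b i \<le> s"
        unfolding s_def using diag
        by (intro member_le_sum[of i UNIV "\<lambda>i. b (replicate m i) - tensor_beta m b i"])
           (auto intro: less_imp_le)
      ultimately show ?thesis using z_diag "is" by simp
    qed
  qed
  show ?thesis
  proof (rule has_SOS_decomposition_if_eigenvalues_le[OF assms(1-3) z_nonneg])
    show "b is - tensor_beta m b (hd is) = s * identity_tensor m is - z is" for "is"
      by (simp add: z_def)
    fix lam and x :: "real ^ 'n"
    assume x: "x \<noteq> 0" "\<And>i. x $ i \<ge> 0" "\<And>i. tensor_apply m z x i = lam * x $ i ^ (m - 1)"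
    show "lam \<le> s"
    proof (rule ccontr)
      assume "\<not> lam \<le> s"
      show False
      proof (rule no_eig[of "lam - s" x])
        fix i :: 'n
        have split: "{js. length js = m - 1} = insert (replicate (m - 1) i) (offdiag m i)"
          by (auto simp: offdiag_def)
        have "lam * x $ i ^ (m - 1) =
            (s - (b (replicate m i) - tensor_beta m b i)) * x $ i ^ (m - 1) +
            (\<Sum>js\<in>offdiag m i. (tensor_beta m b i - b (i # js)) * (\<Prod>j\<leftarrow>js. x $ j))"
          unfolding x(3)[symmetric] tensor_apply_def split
          by (subst sum.insert) (simp_all add: z_diag z_off prod_list_replicate del: One_nat_def, simp add: offdiag_def)
        then show "(b (replicate m i) - tensor_beta m b i + (lam - s)) * x $ i ^ (m - 1) =
            (\<Sum>js\<in>offdiag m i. (tensor_beta m b i - b (i # js)) * (\<Prod>j\<leftarrow>js. x $ j))"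
          by (simp add: algebra_simps)
      qed (use x \<open>\<not> lam \<le> s\<close> in auto)
    qed
  qed
qed

section \<open>Row estimates at a largest coordinate: the double B and quasi-double B0 cases\<close>

text \<open>All coefficients are nonnegative, so every monomial may be replaced by its bound. The
  set \<open>A\<close> is left free because the quasi-double case keeps one tail apart.\<close>

lemma offdiag_sum_le:
  fixes x :: "real ^ 'n::finite"
  assumes "\<And>j. 0 \<le> x $ j" "\<And>j. x $ j \<le> X" "A \<subseteq> offdiag m i"
  shows "(\<Sum>js\<in>A. (tensor_beta m b i - b (i # js)) * (\<Prod>j\<leftarrow>js. x $ j)) \<le>
    (\<Sum>js\<in>A. tensor_beta m b i - b (i # js)) * X ^ (m - 1)"
  unfolding sum_distrib_right
proof (rule sum_mono)
  fix js assume js: "js \<in> A"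
  have "(\<Prod>j\<leftarrow>js. x $ j) \<le> X ^ length js"
    by (induction js) (use assms(1,2) order_trans[OF assms(1,2)] in
      \<open>auto intro!: mult_mono prod_list_nonneg\<close>)
  moreover have "length js = m - 1" using js assms(3) by (auto simp: offdiag_def)
  moreover have "b (i # js) \<le> tensor_beta m b i" using js assms(3) by (intro tensor_beta_ge) auto
  ultimately show "(tensor_beta m b i - b (i # js)) * (\<Prod>j\<leftarrow>js. x $ j) \<le>
      (tensor_beta m b i - b (i # js)) * X ^ (m - 1)"
    by (intro mult_left_mono) auto
qed

lemma vec_nonneg_obtain_max:
  fixes x :: "real ^ 'n::finite"
  assumes "x \<noteq> 0" "\<And>i. x $ i \<ge> 0"
  obtains p where "x $ p > 0" "\<And>i. x $ i \<le> x $ p"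
proof -
  have "Max (range (\<lambda>i. x $ i)) \<in> range (\<lambda>i. x $ i)" by (rule Max_in) auto
  then obtain p where p: "x $ p = Max (range (\<lambda>i. x $ i))" by (metis imageE)
  then have le: "x $ i \<le> x $ p" for i by simp
  obtain j where "x $ j \<noteq> 0" using assms(1) by (auto simp: vec_eq_iff)
  then have "x $ p > 0" using le[of j] assms(2)[of j] by linarith
  then show thesis using le that by blast
qed

text \<open>Covers dimension one, where the conditions on pairs of distinct indices are
  vacuous.\<close>

lemma tensor_Delta_eq_0_if_singleton:
  fixes b :: "'n::finite tensor"
  assumes "\<And>j :: 'n. j = i"
  shows "tensor_Delta m b i = 0"
proof -
  have "offdiag m i = {}"
    using assms by (auto simp: offdiag_def intro!: replicate_eqI)
  then show ?thesis by (simp add: tensor_Delta_def)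
qed

text \<open>In the row of a largest coordinate \<open>p\<close> the eigenvector equation forces the
  diagonal excess plus \<open>d\<close> to be at most \<open>tensor_Delta m b p\<close>, against the
  dominance of that row.\<close>

lemma has_SOS_decomposition_double_B:
  fixes b :: "'n::finite tensor"
  assumes "even m" "m > 0" "symmetric_tensor m b" "double_B_tensor m b"
  shows "has_SOS_decomposition m b"
proof (rule has_SOS_decomposition_if_no_eigenvector[OF assms(1-3)])
  show diag: "b (replicate m i) > tensor_beta m b i" for i
    using assms(4) by (simp add: double_B_tensor_def)
  fix d and x :: "real ^ 'n"
  assume d: "d > 0" and x: "x \<noteq> 0" "\<And>i. x $ i \<ge> 0"
    and eq: "\<And>i. (b (replicate m i) - tensor_beta m b i + d) * x $ i ^ (m - 1) =
        (\<Sum>js\<in>offdiag m i. (tensor_beta m b i - b (i # js)) * (\<Prod>j\<leftarrow>js. x $ j))"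
  obtain p where p: "x $ p > 0" "\<And>i. x $ i \<le> x $ p"
    using vec_nonneg_obtain_max[OF x] by blast
  have "(b (replicate m p) - tensor_beta m b p + d) * x $ p ^ (m - 1) \<le>
      tensor_Delta m b p * x $ p ^ (m - 1)"
    unfolding eq tensor_Delta_def by (intro offdiag_sum_le x p order_refl)
  then have "b (replicate m p) - tensor_beta m b p + d \<le> tensor_Delta m b p"
    using p(1) by simp
  moreover have "tensor_Delta m b p \<le> b (replicate m p) - tensor_beta m b p"
  proof (cases "\<exists>q. q \<noteq> p")
    case True
    then show ?thesis using assms(4) by (metis double_B_tensor_def)
  next
    case False
    then show ?thesis using diag[of p] tensor_Delta_eq_0_if_singleton[of p m b] by auto
  qed
  ultimately show False using d by linarith
qed

text \<open>Two rows are combined. In the row of a largest coordinate \<open>p\<close> the power of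
  \<open>x $ q\<close> is kept exact and all other monomials are estimated; the row of
  \<open>q\<close> then bounds that power. Eliminating it contradicts the quasi-double inequality
  for the pair \<open>q\<close>, \<open>p\<close>, because \<open>d > 0\<close>.\<close>

lemma has_SOS_decomposition_quasi_double_B0:
  fixes b :: "'n::finite tensor"
  assumes "even m" "m > 0" "symmetric_tensor m b" "quasi_double_B0_tensor m b"
  shows "has_SOS_decomposition m b"
proof (rule has_SOS_decomposition_if_no_eigenvector[OF assms(1-3)])
  show diag: "b (replicate m i) > tensor_beta m b i" for i
    using assms(4) by (simp add: quasi_double_B0_tensor_def)
  have "m \<ge> 2" using assms(1,2) by presburger
  fix d and x :: "real ^ 'n"
  assume d: "d > 0" and x: "x \<noteq> 0" "\<And>i. x $ i \<ge> 0"
    and eq: "\<And>i. (b (replicate m i) - tensor_beta m b i + d) * x $ i ^ (m - 1) =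
        (\<Sum>js\<in>offdiag m i. (tensor_beta m b i - b (i # js)) * (\<Prod>j\<leftarrow>js. x $ j))"
  define a where "a i = b (replicate m i) - tensor_beta m b i" for i
  have a: "a i > 0" for i using diag[of i] by (simp add: a_def)
  obtain p where p: "x $ p > 0" "\<And>i. x $ i \<le> x $ p"
    using vec_nonneg_obtain_max[OF x] by blast
  define P where "P = x $ p ^ (m - 1)"
  have "P > 0" using p by (simp add: P_def)
  have row: "(a i + d) * x $ i ^ (m - 1) \<le> tensor_Delta m b i * P" for i
    unfolding a_def eq tensor_Delta_def P_def by (intro offdiag_sum_le x p order_refl)
  show False
  proof (cases "\<exists>q. q \<noteq> p")
    case False
    then have "(a p + d) * P \<le> 0"
      using row[of p] tensor_Delta_eq_0_if_singleton[of p m b] by (auto simp: P_def)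
    then show False using a[of p] d \<open>P > 0\<close> by (simp add: mult_le_0_iff)
  next
    case True
    \<comment> \<open>Any index other than \<open>p\<close> serves, as row \<open>q\<close> is
      estimated by the largest coordinate too.\<close>
    then obtain q where q: "q \<noteq> p" by blast
    define J where "J = replicate (m - 1) q"
    define r where "r = tensor_beta m b p - b (p # J)"
    define D where "D = tensor_Delta_except m b q p"
    define Q where "Q = x $ q ^ (m - 1)"
    \<comment> \<open>The tails are nonempty by \<open>m \<ge> 2\<close>, so
      \<open>q \<noteq> p\<close> separates \<open>J\<close> from the diagonal tail.\<close>
    have J: "J \<in> offdiag m p"
      using q \<open>m \<ge> 2\<close> by (auto simp: J_def offdiag_def replicate_eq_replicate)
    have "r \<ge> 0" using tensor_beta_ge[OF J, of b] by (simp add: r_def)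
    have "D = (\<Sum>js\<in>offdiag m p - {J}. tensor_beta m b p - b (p # js))"
      using sum.remove[OF offdiag_finite J, of "\<lambda>js. tensor_beta m b p - b (p # js)"]
      by (simp add: D_def tensor_Delta_except_def tensor_Delta_def J_def)
    then have "(\<Sum>js\<in>offdiag m p - {J}. (tensor_beta m b p - b (p # js)) * (\<Prod>j\<leftarrow>js. x $ j)) \<le> D * P"
      unfolding P_def by (simp only:) (intro offdiag_sum_le x p Diff_subset)
    moreover have "(a p + d) * P = r * Q +
        (\<Sum>js\<in>offdiag m p - {J}. (tensor_beta m b p - b (p # js)) * (\<Prod>j\<leftarrow>js. x $ j))"
      unfolding a_def P_def eq sum.remove[OF offdiag_finite J]
      by (simp add: r_def Q_def J_def prod_list_replicate)
    ultimately have 1: "(a p + d - D) * P \<le> r * Q" by (simp add: algebra_simps)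
    have 2: "(a q + d) * Q \<le> tensor_Delta m b q * P" using row[of q] by (simp add: Q_def)
    have 3: "r * tensor_Delta m b q \<le> a q * (a p - D)"
      using assms(4) q unfolding quasi_double_B0_tensor_def a_def r_def D_def J_def by blast
    \<comment> \<open>The left side of \<open>3\<close> is nonnegative, which fixes the sign of
      \<open>a p - D\<close>; the strict comparison at the end, where \<open>d\<close> is added to
      both factors, relies on it.\<close>
    have "tensor_Delta m b q \<ge> 0"
      unfolding tensor_Delta_def by (intro sum_nonneg) (simp add: tensor_beta_ge)
    then have "a q * (a p - D) \<ge> 0" using 3 \<open>r \<ge> 0\<close> by (meson mult_nonneg_nonneg order_trans)
    then have 4: "a p - D \<ge> 0" using a[of q] by (simp add: zero_le_mult_iff)
    have "(a q + d) * ((a p + d - D) * P) \<le> (a q + d) * (r * Q)"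
      using 1 a[of q] d by (intro mult_left_mono) auto
    also have "\<dots> = r * ((a q + d) * Q)" by simp
    also have "\<dots> \<le> r * (tensor_Delta m b q * P)"
      using 2 \<open>r \<ge> 0\<close> by (rule mult_left_mono)
    also have "\<dots> = (r * tensor_Delta m b q) * P" by simp
    also have "\<dots> \<le> (a q * (a p - D)) * P"
      using 3 \<open>P > 0\<close> by (intro mult_right_mono) auto
    also have "\<dots> < ((a q + d) * (a p + d - D)) * P"
      using \<open>P > 0\<close> a[of q] d 4 by (intro mult_strict_right_mono mult_strict_mono) auto
    finally show False by simp
  qed
qed

theorem theorem3p6:
  fixes m :: nat and b :: "'n::finite tensor"
  assumes "even m" and "m > 0"
    and "symmetric_tensor m b"
    and "double_B_tensor m b \<or> quasi_double_B0_tensor m b \<or> MB0_tensor m b"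
  shows "has_SOS_decomposition m b"
  using assms(4)
proof (elim disjE)
  assume "double_B_tensor m b"
  then show ?thesis by (rule has_SOS_decomposition_double_B[OF assms(1-3)])
next
  assume "quasi_double_B0_tensor m b"
  then show ?thesis by (rule has_SOS_decomposition_quasi_double_B0[OF assms(1-3)])
next
  assume "MB0_tensor m b"
  then show ?thesis by (rule has_SOS_decomposition_MB0[OF assms(1-3)])
qed

end
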